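(* Let $(\mathcal{L}_t,\mathcal{B}_t,\mathbf{P})$ be any market for liquidity at time $t$ and let $i\in\mathcal{L}_t$, $j\in\mathcal{B}_t$ denote lenders and borrowers. For any possible matching $\mu_t$ such that $r_{ij}<\bar r_j$ for all $\mu_t(i)=j$, there exists a systemic risk tax $\mathcal{T}=(\tau_{ij})$, $\tau_{ij}\ge 0$, such that $\mu_t^{*,\mathcal{T}}=\mu_t$ is the unique stable matching (in the market taxed by $\mathcal{T}$). The set $\overline{\mathcal{EQ}}_t$ of possible stable matchings that can be sustained as a unique equilibrium in this way is a superset of the set $\mathcal{EQ}_t$ of possible stable matchings that can arise without the tax, i.e. $\overline{\mathcal{EQ}}_t\supseteq\mathcal{EQ}_t$.
   Context: **Market.** $\mathcal{N}$ is a finite set of banks; $\mathcal{L}_t,\mathcal{B}_t\subseteq\mathcal{N}$ are disjoint sets (potential lenders and potential borrowers); $\mathbf{P}$ is the collection of all preference lists described below. Each lender $i$ has a base rate $r_i$, and the $r_i$ are strictly ordered (pairwise distinct). Each borrower $j$ has a reservation rate $\bar r_j$ and a default probability $\rho_j\in[0,1)$ on a loan of maturity $S\in\{1,2,\dots\}$ periods. All these quantities are given and commonly known. **Bilateral contracting mechanism.** The risk premium is $h_{ij}=\frac{1+r_i}{(1-\rho_j)^{1/S}}-1-r_i$, and the rate paid by $j$ when borrowing from $i$ is $r_{ij}=r_i+h_{ij}$. Under a systemic risk tax, i.e. a matrix $\mathcal{T}=(\tau_{ij})_{i\in\mathcal{L}_t,\,j\in\mathcal{B}_t}$ with $\tau_{ij}\ge0$,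 the rate paid becomes $r^{\mathcal{T}}_{ij}=r_i+h_{ij}+\tau_{ij}$; reservation rates and lenders' preferences do not change. **Preferences.** Borrower $j$ prefers an option with a lower rate, where the option "borrow from lender $i$" has rate $r_{ij}$ (or $r^{\mathcal{T}}_{ij}$ in the taxed market) and the option "stay unmatched" (denoted $j$) has rate $\bar r_j$. Every lender is indifferent among all borrowers. **Matching.** A matching $\mu_t$ is a one-to-one correspondence from $\mathcal{N}$ onto itself with $\mu_t(\mu_t(a))=a$ for all $a$, such that for any $b\in\mathcal{B}_t$, if $\mu_t(b)\neq b$ then $\mu_t(b)\in\mathcal{L}_t$, and for any $l\in\mathcal{L}_t$, if $\mu_t(l)\neq l$ then $\mu_t(l)\in\mathcal{B}_t$. A bank $a$ with $\mu_t(a)=a$ is unmatched. **Stable matching.** A matching $\mu^*$ is stable if: (I) (pairwise deviation) for all $i,l\in\mathcal{L}_t$ and $k,j\in\mathcal{B}_t$ such that $\mu^*(i)=j$ and $\mu^*(k)=l$, it cannot be that both $i$ strictly prefers $k$ to $j$ and $k$ strictly prefers $i$ to $l$; (II) (coalitional deviation) let $\vec b\subseteq\mathcal{B}_t$ be a set of borrowers such that their assigned lenders are indifferent between any borrowers in $\vec b$ (for any $j,k\in\vec b$, lender $\mu^*(j)$ is indifferent between $j$ and $k$); then there cannot be another matching $\mu'$ such that every $j\in\vec b$ strictly prefers $\mu'(j)$ to $\mu^*(j)$ (this condition expresses that no group of borrowing banks can agree to swap counter-parties if their lenders are indifferent); (III) (unilateral deviation) for any $j\in\mathcal{B}_t$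 with $\mu^*(j)\neq j$, it cannot be that $j$ strictly prefers staying unmatched to $\mu^*(j)$; and for any $j\in\mathcal{B}_t$, it cannot be that $j$ strictly prefers to $\mu^*(j)$ some $k\in\mathcal{L}_t$ with $\mu^*(k)=k$. **Sets of matchings.** $\overline{\mathcal{EQ}}_t$ is the set of matchings $\mu_t$ such that $r_{ij}<\bar r_j$ for all $\mu_t(i)=j$, $i\in\mathcal{L}_t$, $j\in\mathcal{B}_t$. $\mathcal{EQ}_t$ is the set of matchings $\mu_t$ such that $r_{ij}<\bar r_j$ for any $\mu_t(i)=j$ ($i\in\mathcal{L}_t$, $j\in\mathcal{B}_t$) and $r_{ij}<r_{kj}$ for any such pair and any $k\in\mathcal{L}_t$ with $\mu_t(k)=k$.
   Formalization: "Unique" means that every stable matching agrees with μ_t on all lenders and borrowers (banks in neither set may be paired with each other arbitrarily), and in condition (II) the set of borrowers is required to be nonempty with every member matched to a lender. *)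

theory Defs
  imports Complex_Main "HOL-Combinatorics.Permutations"
begin

text \<open>
  \<open>lender_pref M i j k\<close> means that lender \<open>i\<close> weakly prefers being matched to \<open>j\<close> over being
  matched to \<open>k\<close>.  Borrowers' preferences are not a field: they are induced by the rates.
\<close>

record 'a market =
  banks :: "'a set"
  lenders :: "'a set"
  borrowers :: "'a set"
  base_rate :: "'a \<Rightarrow> real"
  res_rate :: "'a \<Rightarrow> real"
  default_prob :: "'a \<Rightarrow> real"
  maturity :: nat
  lender_pref :: "'a \<Rightarrow> 'a \<Rightarrow> 'a \<Rightarrow> bool"

definition liquidity_market :: "'a market \<Rightarrow> bool" where
  "liquidity_market M \<longleftrightarrow>
     finite (banks M) \<and>
     lenders M \<subseteq> banks M \<and> borrowers M \<subseteq> banks M \<and>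
     lenders M \<inter> borrowers M = {} \<and>
     inj_on (base_rate M) (lenders M) \<and>
     (\<forall>j\<in>borrowers M. 0 \<le> default_prob M j \<and> default_prob M j < 1) \<and>
     1 \<le> maturity M \<and>
     (\<forall>i\<in>lenders M. \<forall>j\<in>borrowers M. \<forall>k\<in>borrowers M. lender_pref M i j k)"

definition risk_premium :: "'a market \<Rightarrow> 'a \<Rightarrow> 'a \<Rightarrow> real" where
  "risk_premium M i j =
     (1 + base_rate M i) / (1 - default_prob M j) powr (1 / real (maturity M))
       - 1 - base_rate M i"

definition rate :: "'a market \<Rightarrow> 'a \<Rightarrow> 'a \<Rightarrow> real" where
  "rate M i j = base_rate M i + risk_premium M i j"

text \<open>
  A tax matrix is a function of lender and borrower; only its entries on
  \<open>lenders M \<times> borrowers M\<close> matter.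
\<close>

definition systemic_risk_tax :: "'a market \<Rightarrow> ('a \<Rightarrow> 'a \<Rightarrow> real) \<Rightarrow> bool" where
  "systemic_risk_tax M \<tau> \<longleftrightarrow> (\<forall>i\<in>lenders M. \<forall>j\<in>borrowers M. 0 \<le> \<tau> i j)"

definition taxed_rate :: "'a market \<Rightarrow> ('a \<Rightarrow> 'a \<Rightarrow> real) \<Rightarrow> 'a \<Rightarrow> 'a \<Rightarrow> real" where
  "taxed_rate M \<tau> i j = base_rate M i + risk_premium M i j + \<tau> i j"

text \<open>For borrower \<open>j\<close>, the option \<open>j\<close> itself stands for staying unmatched.\<close>

definition option_rate :: "'a market \<Rightarrow> ('a \<Rightarrow> 'a \<Rightarrow> real) \<Rightarrow> 'a \<Rightarrow> 'a \<Rightarrow> real" where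
  "option_rate M \<tau> j x = (if x = j then res_rate M j else taxed_rate M \<tau> x j)"

definition borrower_strictly_prefers ::
  "'a market \<Rightarrow> ('a \<Rightarrow> 'a \<Rightarrow> real) \<Rightarrow> 'a \<Rightarrow> 'a \<Rightarrow> 'a \<Rightarrow> bool" where
  "borrower_strictly_prefers M \<tau> j x y \<longleftrightarrow> option_rate M \<tau> j x < option_rate M \<tau> j y"

definition lender_strictly_prefers :: "'a market \<Rightarrow> 'a \<Rightarrow> 'a \<Rightarrow> 'a \<Rightarrow> bool" where
  "lender_strictly_prefers M i j k \<longleftrightarrow> lender_pref M i j k \<and> \<not> lender_pref M i k j"

definition lender_indifferent :: "'a market \<Rightarrow> 'a \<Rightarrow> 'a \<Rightarrow> 'a \<Rightarrow> bool" where
  "lender_indifferent M i j k \<longleftrightarrow> lender_pref M i j k \<and> lender_pref M i k j"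

text \<open>
  A bijection of the set of banks onto itself is represented by the function that extends it
  by the identity.  Banks that are neither lenders nor borrowers are not constrained
  beyond the involution property.
\<close>

definition matching :: "'a market \<Rightarrow> ('a \<Rightarrow> 'a) \<Rightarrow> bool" where
  "matching M \<mu> \<longleftrightarrow>
     \<mu> permutes banks M \<and>
     (\<forall>a\<in>banks M. \<mu> (\<mu> a) = a) \<and>
     (\<forall>b\<in>borrowers M. \<mu> b \<noteq> b \<longrightarrow> \<mu> b \<in> lenders M) \<and>
     (\<forall>l\<in>lenders M. \<mu> l \<noteq> l \<longrightarrow> \<mu> l \<in> borrowers M)"

definition no_pairwise_deviation ::
  "'a market \<Rightarrow> ('a \<Rightarrow> 'a \<Rightarrow> real) \<Rightarrow> ('a \<Rightarrow> 'a) \<Rightarrow> bool" where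
  "no_pairwise_deviation M \<tau> \<mu> \<longleftrightarrow>
     (\<forall>i\<in>lenders M. \<forall>l\<in>lenders M. \<forall>k\<in>borrowers M. \<forall>j\<in>borrowers M.
        \<mu> i = j \<and> \<mu> k = l \<longrightarrow>
        \<not> (lender_strictly_prefers M i k j \<and> borrower_strictly_prefers M \<tau> k i l))"

text \<open>
  The coalition has to be nonempty: for the empty one every matching would vacuously be an
  improvement.  Its members are matched, since the condition speaks of their assigned
  lenders.  The improving matching is otherwise arbitrary; it may use lenders that are not
  matched to the coalition under \<open>\<mu>\<close>.
\<close>

definition no_coalitional_deviation ::
  "'a market \<Rightarrow> ('a \<Rightarrow> 'a \<Rightarrow> real) \<Rightarrow> ('a \<Rightarrow> 'a) \<Rightarrow> bool" where
  "no_coalitional_deviation M \<tau> \<mu> \<longleftrightarrow>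
     (\<forall>b. b \<subseteq> borrowers M \<and> b \<noteq> {} \<and> (\<forall>j\<in>b. \<mu> j \<in> lenders M) \<and>
          (\<forall>j\<in>b. \<forall>k\<in>b. lender_indifferent M (\<mu> j) j k) \<longrightarrow>
        \<not> (\<exists>\<mu>'. matching M \<mu>' \<and> \<mu>' \<noteq> \<mu> \<and>
                (\<forall>j\<in>b. borrower_strictly_prefers M \<tau> j (\<mu>' j) (\<mu> j))))"

definition no_unilateral_deviation ::
  "'a market \<Rightarrow> ('a \<Rightarrow> 'a \<Rightarrow> real) \<Rightarrow> ('a \<Rightarrow> 'a) \<Rightarrow> bool" where
  "no_unilateral_deviation M \<tau> \<mu> \<longleftrightarrow>
     (\<forall>j\<in>borrowers M. \<mu> j \<noteq> j \<longrightarrow> \<not> borrower_strictly_prefers M \<tau> j j (\<mu> j)) \<and>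
     (\<forall>j\<in>borrowers M. \<forall>k\<in>lenders M.
        \<mu> k = k \<longrightarrow> \<not> borrower_strictly_prefers M \<tau> j k (\<mu> j))"

definition stable_matching ::
  "'a market \<Rightarrow> ('a \<Rightarrow> 'a \<Rightarrow> real) \<Rightarrow> ('a \<Rightarrow> 'a) \<Rightarrow> bool" where
  "stable_matching M \<tau> \<mu> \<longleftrightarrow>
     matching M \<mu> \<and>
     no_pairwise_deviation M \<tau> \<mu> \<and>
     no_coalitional_deviation M \<tau> \<mu> \<and>
     no_unilateral_deviation M \<tau> \<mu>"

text \<open>
  Two matchings are identified when they agree on all lenders and borrowers.  The definitions
  of matching and stability put no restriction on how banks outside the market are paired
  with each other, so equality on all of \<open>banks M\<close> cannot be expected when there are at
  least two such banks.
\<close>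

definition unique_stable_matching ::
  "'a market \<Rightarrow> ('a \<Rightarrow> 'a \<Rightarrow> real) \<Rightarrow> ('a \<Rightarrow> 'a) \<Rightarrow> bool" where
  "unique_stable_matching M \<tau> \<mu> \<longleftrightarrow>
     stable_matching M \<tau> \<mu> \<and>
     (\<forall>\<nu>. stable_matching M \<tau> \<nu> \<longrightarrow> (\<forall>a\<in>lenders M \<union> borrowers M. \<nu> a = \<mu> a))"

definition EQ_bar :: "'a market \<Rightarrow> ('a \<Rightarrow> 'a) set" where
  "EQ_bar M =
     {\<mu>. matching M \<mu> \<and>
         (\<forall>i\<in>lenders M. \<forall>j\<in>borrowers M. \<mu> i = j \<longrightarrow> rate M i j < res_rate M j)}"

definition EQ :: "'a market \<Rightarrow> ('a \<Rightarrow> 'a) set" where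
  "EQ M =
     {\<mu>. matching M \<mu> \<and>
         (\<forall>i\<in>lenders M. \<forall>j\<in>borrowers M. \<mu> i = j \<longrightarrow>
            rate M i j < res_rate M j \<and>
            (\<forall>k\<in>lenders M. \<mu> k = k \<longrightarrow> rate M i j < rate M k j))}"

end

theory Submission imports Defs begin

text \<open>
  Tax every pair that is not matched by \<open>\<mu>\<close> so heavily that the taxed rate exceeds the
  borrower's reservation rate.  Then \<open>\<mu>\<close> gives each borrower its unique best option, which
  makes \<open>\<mu>\<close> stable.  In a stable matching a matched borrower must have its \<open>\<mu>\<close>-lender; so if a
  borrower went unmatched, its \<open>\<mu>\<close>-lender would be free as well, which is a unilateral
  deviation.
\<close>

text \<open>The summand \<open>1\<close> puts the taxed rate of a pair outside \<open>\<mu>\<close>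
  strictly above the reservation rate, and \<open>max 0\<close> keeps the tax nonnegative where the
  rate is already that high.\<close>

definition separating_tax :: "'a market \<Rightarrow> ('a \<Rightarrow> 'a) \<Rightarrow> 'a \<Rightarrow> 'a \<Rightarrow> real" where
  "separating_tax M \<mu> i j = (if \<mu> j = i then 0 else max 0 (res_rate M j - rate M i j + 1))"

lemma systemic_risk_tax_separating_tax: "systemic_risk_tax M (separating_tax M \<mu>)"
  by (simp add: systemic_risk_tax_def separating_tax_def)

text \<open>On \<open>banks M\<close> this is part of the definition; elsewhere
  \<open>permutes\<close> makes \<open>\<mu>\<close> the identity.\<close>

lemma matching_involution:
  assumes "matching M \<mu>"
  shows "\<mu> (\<mu> a) = a"
  using assms unfolding matching_def by (metis permutes_not_in)

lemma matching_borrower_cases: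
  assumes "matching M \<mu>" and "j \<in> borrowers M"
  obtains "\<mu> j = j" | "\<mu> j \<in> lenders M"
  using assms unfolding matching_def by metis

lemma matching_lender_cases:
  assumes "matching M \<mu>" and "l \<in> lenders M"
  obtains "\<mu> l = l" | "\<mu> l \<in> borrowers M"
  using assms unfolding matching_def by metis

lemma res_rate_less_option_rate:
  assumes "x \<noteq> j" and "x \<noteq> \<mu> j"
  shows "res_rate M j < option_rate M (separating_tax M \<mu>) j x"
  using assms
  by (auto simp: option_rate_def taxed_rate_def rate_def separating_tax_def)

lemma option_rate_match_less_res_rate:
  assumes "\<mu> \<in> EQ_bar M" and "j \<in> borrowers M" and "\<mu> j \<noteq> j"
  shows "option_rate M (separating_tax M \<mu>) j (\<mu> j) < res_rate M j"
proof -
  have \<mu>: "matching M \<mu>"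
    using assms(1) by (simp add: EQ_bar_def)
  then have "\<mu> j \<in> lenders M"
    using assms(2,3) by (auto elim: matching_borrower_cases)
  \<comment> \<open>\<open>EQ_bar\<close> describes matched pairs from the lender's side, so it is
    applied to the lender \<open>\<mu> j\<close>, whose partner is \<open>j\<close> by
    involution.\<close>
  then have "rate M (\<mu> j) j < res_rate M j"
    using assms(1,2) matching_involution[OF \<mu>, of j] unfolding EQ_bar_def by blast
  then show ?thesis
    using assms(3) by (simp add: option_rate_def taxed_rate_def rate_def separating_tax_def)
qed

text \<open>The reservation rate is a threshold: the option \<open>\<mu> j\<close> costs at most
  that much, and every other option at least that much.\<close>

lemma borrower_not_strictly_prefers:
  assumes "\<mu> \<in> EQ_bar M" and "j \<in> borrowers M"
  shows "\<not> borrower_strictly_prefers M (separating_tax M \<mu>) j x (\<mu> j)"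
proof -
  have "option_rate M (separating_tax M \<mu>) j (\<mu> j) \<le> res_rate M j"
    using option_rate_match_less_res_rate[OF assms]
    by (cases "\<mu> j = j") (simp_all add: option_rate_def)
  moreover have "x = \<mu> j \<or> res_rate M j \<le> option_rate M (separating_tax M \<mu>) j x"
  proof (cases "x = j")
    case False
    then show ?thesis
      using res_rate_less_option_rate[of x j \<mu> M] less_imp_le by blast
  qed (simp add: option_rate_def)
  ultimately show ?thesis
    by (auto simp: borrower_strictly_prefers_def)
qed

text \<open>Each kind of deviation requires some borrower to gain strictly over its option under
  \<open>\<mu>\<close>; for a coalition, nonemptiness supplies such a borrower.\<close>

lemma stable_matching_separating_tax:
  assumes "\<mu> \<in> EQ_bar M"
  shows "stable_matching M (separating_tax M \<mu>) \<mu>"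
proof -
  note best = borrower_not_strictly_prefers[OF assms]
  have "no_pairwise_deviation M (separating_tax M \<mu>) \<mu>"
    using best unfolding no_pairwise_deviation_def by metis
  moreover have "no_coalitional_deviation M (separating_tax M \<mu>) \<mu>"
    using best unfolding no_coalitional_deviation_def by blast
  moreover have "no_unilateral_deviation M (separating_tax M \<mu>) \<mu>"
    using best unfolding no_unilateral_deviation_def by blast
  ultimately show ?thesis
    using assms by (simp add: stable_matching_def EQ_bar_def)
qed

lemma stable_matching_separating_tax_unique:
  assumes "\<mu> \<in> EQ_bar M" and "stable_matching M (separating_tax M \<mu>) \<nu>"
    and "a \<in> lenders M \<union> borrowers M"
  shows "\<nu> a = \<mu> a"
proof -
  have \<mu>: "matching M \<mu>"
    using assms(1) by (simp add: EQ_bar_def)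
  have \<nu>: "matching M \<nu>" and stable: "no_unilateral_deviation M (separating_tax M \<mu>) \<nu>"
    using assms(2) by (simp_all add: stable_matching_def)
  have matched: "\<nu> j = \<mu> j" if "j \<in> borrowers M" "\<nu> j \<noteq> j" for j
  proof (rule ccontr)
    assume "\<nu> j \<noteq> \<mu> j"
    then have "borrower_strictly_prefers M (separating_tax M \<mu>) j j (\<nu> j)"
      using res_rate_less_option_rate[of "\<nu> j" j \<mu> M] that
      by (simp add: borrower_strictly_prefers_def option_rate_def)
    then show False
      using stable that by (simp add: no_unilateral_deviation_def)
  qed
  have borrower: "\<nu> j = \<mu> j" if j: "j \<in> borrowers M" for j
  proof (rule ccontr)
    assume neq: "\<nu> j \<noteq> \<mu> j"
    then have unmatched: "\<nu> j = j" "\<mu> j \<noteq> j"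
      using matched j by metis+
    then have lender: "\<mu> j \<in> lenders M"
      using \<mu> j by (auto elim: matching_borrower_cases)
    \<comment> \<open>If \<open>\<nu>\<close> gave the lender \<open>\<mu> j\<close> to a borrower
      \<open>b\<close>, then \<open>matched\<close> would yield
      \<open>\<mu> b = \<nu> b = \<mu> j\<close>, hence \<open>b = j\<close> and
      \<open>\<nu> j = \<mu> j\<close>.\<close>
    have "\<nu> (\<mu> j) = \<mu> j"
    proof (rule ccontr)
      assume taken: "\<nu> (\<mu> j) \<noteq> \<mu> j"
      then have "\<nu> (\<mu> j) \<in> borrowers M"
        using \<nu> lender by (auto elim: matching_lender_cases)
      then have "\<mu> (\<nu> (\<mu> j)) = \<mu> j"
        using matched[of "\<nu> (\<mu> j)"] taken matching_involution[OF \<nu>] by metis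
      then show False
        using neq matching_involution[OF \<nu>] matching_involution[OF \<mu>] by metis
    qed
    \<comment> \<open>Being unmatched in \<open>\<nu>\<close>, \<open>j\<close> faces its
      reservation rate, which the untaxed rate of \<open>\<mu> j\<close> undercuts strictly.\<close>
    moreover have "borrower_strictly_prefers M (separating_tax M \<mu>) j (\<mu> j) (\<nu> j)"
      using option_rate_match_less_res_rate[OF assms(1) j unmatched(2)] unmatched(1)
      by (simp add: borrower_strictly_prefers_def option_rate_def)
    ultimately show False
      using stable lender j unfolding no_unilateral_deviation_def by blast
  qed
  show ?thesis
  proof (cases "a \<in> borrowers M")
    case False
    then have "a \<in> lenders M"
      using assms(3) by blast
    \<comment> \<open>A borrower paired with \<open>a\<close> by one of the matchings is paired with
      \<open>a\<close> by the other too, since they agree on borrowers; otherwise both fix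
      \<open>a\<close>.\<close>
    then have "\<nu> a = a \<or> \<nu> a \<in> borrowers M" "\<mu> a = a \<or> \<mu> a \<in> borrowers M"
      using \<nu> \<mu> matching_lender_cases by metis+
    then show ?thesis
      using borrower matching_involution[OF \<nu>] matching_involution[OF \<mu>] by metis
  qed (simp add: borrower)
qed

theorem theorem1:
  fixes M :: "'a market"
  assumes "liquidity_market M"
  shows "(\<forall>\<mu>. matching M \<mu> \<and>
            (\<forall>i\<in>lenders M. \<forall>j\<in>borrowers M. \<mu> i = j \<longrightarrow> rate M i j < res_rate M j) \<longrightarrow>
            (\<exists>\<tau>. systemic_risk_tax M \<tau> \<and> unique_stable_matching M \<tau> \<mu>))
         \<and> EQ_bar M \<supseteq> EQ M"
proof (intro conjI allI impI)
  fix \<mu>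
  assume "matching M \<mu> \<and>
    (\<forall>i\<in>lenders M. \<forall>j\<in>borrowers M. \<mu> i = j \<longrightarrow> rate M i j < res_rate M j)"
  then have "\<mu> \<in> EQ_bar M"
    by (simp add: EQ_bar_def)
  then have "unique_stable_matching M (separating_tax M \<mu>) \<mu>"
    unfolding unique_stable_matching_def
    by (intro conjI allI impI ballI stable_matching_separating_tax
        stable_matching_separating_tax_unique)
  then show "\<exists>\<tau>. systemic_risk_tax M \<tau> \<and> unique_stable_matching M \<tau> \<mu>"
    using systemic_risk_tax_separating_tax by blast
next
  \<comment> \<open>\<open>EQ\<close> only adds the comparison with unmatched lenders to the
    condition of \<open>EQ_bar\<close>.\<close>
  show "EQ_bar M \<supseteq> EQ M"
    by (auto simp: EQ_def EQ_bar_def)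
qed

end
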